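(* Assume that $1<\beta<2$ and $P(Z_1>x)\sim x^{-\beta}L(x)$ as $x\to+\infty$. Then for every $x\in(-\infty,+\infty)$, $$\lim_{n\to\infty}P\left(\frac{m^n}{b(m^n)}\left(\frac{Z_{n+1}}{Z_n}-m\right)\le x\right)=\int_0^\infty P\left(U_s\le u^{\frac{\beta-1}{\beta}}x\right)\omega(u)\,du .$$
   Context: $(Z_n)_{n\ge0}$ is a Galton-Watson process with $Z_0=1$ and offspring distribution $\{p_k\}_{k\ge0}$ such that $p_0=0$, $0<p_1<1$, with finite mean $m=\sum_{k\ge1}kp_k>1$ and $E[Z_1\log Z_1]<\infty$. Then $W=\lim_{n\to\infty}Z_n/m^n$ exists almost surely and has a continuous density $\omega$ on $(0,\infty)$. $L$ is a (positive) slowly varying function, bounded away from $0$ and $\infty$ on every compact subset of $[0,\infty)$. Let $X_1,X_2,\dots$ be i.i.d. copies of $Z_1-m$ and $S_k=X_1+\cdots+X_k$. Then $X_1$ is in the domain of attraction of a $\beta$-stable law: $b(k)^{-1}S_k\to U_s$ in distribution, where $U_s$ is a strictly $\beta$-stable random variable and $b:[0,\infty)\to[0,\infty)$ is a fixed continuous, increasing, onto function with $b(0)=0$ and $b(x)=x^{1/\beta}s(x)$ for $x>0$ with $s:(0,\infty)\to(0,\infty)$ slowly varying. It is a standing assumption that $\liminf_{x\to+\infty}s(x)\in(0,+\infty]$. *)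

theory Defs
  imports "HOL-Probability.Probability" "HOL-Library.Landau_Symbols"
begin

text \<open>
  The variable \<open>\<xi> n i\<close> is the number of children of the \<open>i\<close>-th individual of generation \<open>n\<close>.
\<close>

definition galton_watson :: "'a measure \<Rightarrow> nat pmf \<Rightarrow> (nat \<Rightarrow> 'a \<Rightarrow> nat) \<Rightarrow> bool" where
  "galton_watson M p Z \<longleftrightarrow>
     prob_space M \<and>
     (\<exists>\<xi> :: nat \<Rightarrow> nat \<Rightarrow> 'a \<Rightarrow> nat.
        prob_space.indep_vars M (\<lambda>_. count_space UNIV) (\<lambda>(n, i). \<xi> n i) UNIV \<and>
        (\<forall>n i. distr M (count_space UNIV) (\<xi> n i) = measure_pmf p) \<and>
        (\<forall>w\<in>space M. Z 0 w = 1) \<and>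
        (\<forall>n. \<forall>w\<in>space M. Z (Suc n) w = (\<Sum>i<Z n w. \<xi> n i w)))"

text \<open>
  Slow variation at infinity in the sense of Karamata. Only the values on \<open>(0, \<infinity>)\<close> matter.
\<close>

definition slowly_varying :: "(real \<Rightarrow> real) \<Rightarrow> bool" where
  "slowly_varying f \<longleftrightarrow>
     f \<in> borel_measurable (restrict_space borel {0<..}) \<and>
     (\<forall>x>0. f x > 0) \<and>
     (\<forall>c>0. ((\<lambda>x. f (c * x) / f x) \<longlongrightarrow> 1) at_top)"

text \<open>
  Strict stability of index \<open>\<alpha>\<close> of a law \<open>\<mu>\<close>: if \<open>U\<^sub>1\<close> and \<open>U\<^sub>2\<close> are independent with law \<open>\<mu>\<close>,
  then \<open>a U\<^sub>1 + c U\<^sub>2\<close> has the law of \<open>(a\<^sup>\<alpha> + c\<^sup>\<alpha>)\<^sup>1\<^sup>/\<^sup>\<alpha> U\<^sub>1\<close> for all \<open>a, c > 0\<close>.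
  Point masses are excluded, as usual for stable laws.
\<close>

definition strictly_stable :: "real \<Rightarrow> real measure \<Rightarrow> bool" where
  "strictly_stable \<alpha> \<mu> \<longleftrightarrow>
     real_distribution \<mu> \<and>
     (\<forall>y. \<mu> \<noteq> return borel y) \<and>
     (\<forall>a>0. \<forall>c>0.
        distr (\<mu> \<Otimes>\<^sub>M \<mu>) borel (\<lambda>(u, v). a * u + c * v) =
        distr \<mu> borel (\<lambda>u. (a powr \<alpha> + c powr \<alpha>) powr (1 / \<alpha>) * u))"

end

theory Submission
  imports Defs
begin

text \<open>
  Given \<open>Z n = k\<close>, the difference \<open>Z (n + 1) - m k\<close> is distributed as \<open>S\<^sub>k\<close>, so the probability in
  question is \<open>E[F\<^bsub>Z n\<^esub>(y n)]\<close>, where \<open>F\<^sub>k\<close> is the distribution function of \<open>S\<^sub>k / b k\<close> and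
  \<open>y n = x (Z n / m\<^sup>n) (b (m\<^sup>n) / b (Z n))\<close>. Regular variation of \<open>b\<close> gives
  \<open>y n \<longlonglongrightarrow> x W powr (1 - 1 / \<beta>)\<close> almost surely, and dominated convergence concludes as soon as this limit
  avoids the atoms of \<open>U\<close>. For \<open>x \<noteq> 0\<close> it does, because \<open>W\<close> has a density and there are only
  countably many atoms; for \<open>x = 0\<close> one needs that a strictly stable law has no atom at \<open>0\<close>.
\<close>

section \<open>Atoms of strictly stable laws\<close>

text \<open>By stability, \<open>a U1 + U2\<close> for independent copies \<open>U1\<close>,
  \<open>U2\<close> vanishes with the same probability \<open>q\<close> as \<open>U1\<close>. For
  all but countably many \<open>a\<close> the sum vanishes, up to a null event, only if both copies
  do, so \<open>q = q * q\<close>. The value \<open>q = 1\<close> would give a point mass at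
  \<open>0\<close>, which the definition excludes.\<close>

lemma strictly_stable_no_atom_at_0:
  assumes "strictly_stable \<alpha> \<mu>"
  shows "measure \<mu> {0} = 0"
proof -
  interpret real_distribution \<mu>
    using assms by (simp add: strictly_stable_def)
  define q where "q = emeasure \<mu> {0}"
  define A where "A = {t. measure \<mu> {t} \<noteq> 0}"
  have A: "countable A"
    unfolding A_def by (rule countable_support)
  \<comment> \<open>With this \<open>a\<close>, no pair of nonzero atoms contributes to \<open>P(a U\<^sub>1 + U\<^sub>2 = 0)\<close>.\<close>
  obtain a where a: "0 < a" "a \<notin> (\<lambda>(t, u). - t / u) ` (A \<times> A)"
    using real_interval_avoid_countable_set[of 0 1 "(\<lambda>(t, u). - t / u) ` (A \<times> A)"] A by auto
  \<comment> \<open>The points that are not atoms but whose partner \<open>- a * u\<close> is one.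
    They are countably many and each has mass zero, so \<open>B\<close> is null.\<close>
  define B where "B = (\<lambda>t. - t / a) ` A - A"
  have "AE u in \<mu>. \<forall>y\<in>B. u \<noteq> y"
  proof (rule AE_ball_countable')
    show "countable B"
      using A by (simp add: B_def)
    fix y assume "y \<in> B"
    then have "emeasure \<mu> {y} = 0"
      by (simp add: B_def A_def emeasure_eq_measure)
    then have "{y} \<in> null_sets \<mu>"
      by (simp add: null_sets_def)
    then show "AE u in \<mu>. u \<noteq> y"
      using AE_not_in[of "{y}" \<mu>] by simp
  qed
  then have AE: "AE u in \<mu>. emeasure \<mu> {- a * u} = q * indicator {0} u"
  proof eventually_elim
    case (elim u)
    show ?case
    proof (cases "u = 0")
      case False
      \<comment> \<open>If \<open>- a * u\<close> were an atom, then so would be \<open>u\<close>,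
        because it lies outside \<open>B\<close>; but then \<open>a\<close> would be one of the
        avoided quotients.\<close>
      have "- a * u \<notin> A"
      proof
        assume *: "- a * u \<in> A"
        have "u = - (- a * u) / a" "a = - (- a * u) / u"
          using a False by auto
        then have "u \<in> A"
          using elim * unfolding B_def by blast
        then show False
          using a(2) * \<open>a = - (- a * u) / u\<close> by force
      qed
      then show ?thesis
        using False by (simp add: A_def emeasure_eq_measure)
    qed (simp add: q_def)
  qed
  define k where "k = (a powr \<alpha> + 1 powr \<alpha>) powr (1 / \<alpha>)"
  have "k > 0"
    using add_pos_pos[of "a powr \<alpha>" 1] a(1) by (simp add: k_def)
  \<comment> \<open>The stability identity is evaluated at \<open>{0}\<close>: scaling by
    \<open>k > 0\<close> fixes \<open>0\<close>, and the other side is computed by Fubini.\<close>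
  have "q = emeasure (distr \<mu> borel (\<lambda>u. k * u)) {0}"
  proof -
    have "(\<lambda>u. k * u) -` {0} \<inter> space \<mu> = {0}"
      using \<open>k > 0\<close> by auto
    then show ?thesis
      by (subst emeasure_distr) (auto simp: q_def)
  qed
  also have "distr \<mu> borel (\<lambda>u. k * u) = distr (\<mu> \<Otimes>\<^sub>M \<mu>) borel (\<lambda>(u, v). a * u + 1 * v)"
    using assms a(1) unfolding strictly_stable_def k_def by (metis zero_less_one)
  also have "emeasure \<dots> {0} = emeasure (\<mu> \<Otimes>\<^sub>M \<mu>) ((\<lambda>(u, v). a * u + 1 * v) -` {0} \<inter> space (\<mu> \<Otimes>\<^sub>M \<mu>))"
    by (subst emeasure_distr) auto
  also have "\<dots> = (\<integral>\<^sup>+u. emeasure \<mu> (Pair u -` ((\<lambda>(u, v). a * u + 1 * v) -` {0} \<inter> space (\<mu> \<Otimes>\<^sub>M \<mu>))) \<partial>\<mu>)"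
    by (intro emeasure_pair_measure_alt measurable_sets[of _ _ borel]) auto
  also have "\<dots> = (\<integral>\<^sup>+u. emeasure \<mu> {- a * u} \<partial>\<mu>)"
    by (intro nn_integral_cong arg_cong[where f = "emeasure \<mu>"])
       (auto simp: space_pair_measure)
  also have "\<dots> = (\<integral>\<^sup>+u. q * indicator {0} u \<partial>\<mu>)"
    using AE by (rule nn_integral_cong_AE)
  also have "\<dots> = q * q"
    by (simp add: q_def nn_integral_cmult_indicator)
  finally have "measure \<mu> {0} = measure \<mu> {0} * measure \<mu> {0}"
    by (simp add: q_def emeasure_eq_measure ennreal_mult[symmetric])
  moreover have "measure \<mu> {0} \<noteq> 1"
  proof
    assume "measure \<mu> {0} = 1"
    then have *: "AE u in \<mu>. u \<in> {0}"
      using AE_in_set_eq_1[of "{0}"] by simp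
    have "\<mu> = return borel 0"
    proof (rule measure_eqI)
      fix S assume S: "S \<in> sets \<mu>"
      have "emeasure \<mu> S = (\<integral>\<^sup>+u. indicator S u \<partial>\<mu>)"
        using S by simp
      also have "\<dots> = (\<integral>\<^sup>+u. indicator S 0 \<partial>\<mu>)"
        using * by (intro nn_integral_cong_AE) auto
      also have "\<dots> = emeasure (return borel 0) S"
        using S by (simp add: emeasure_space_1[unfolded borel_UNIV])
      finally show "emeasure \<mu> S = emeasure (return borel 0) S" .
    qed simp
    then show False
      using assms unfolding strictly_stable_def by blast
  qed
  ultimately show ?thesis
    by auto
qed

section \<open>Distribution functions and regularly varying functions at moving arguments\<close>

text \<open>Weak convergence controls only fixed arguments. Monotonicity of distribution functions
  extends this to \<open>y n\<close>: the value there is compared with the value at one fixed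
  \<open>z\<close> on either side of \<open>l\<close>. Since atoms are countable, \<open>z\<close>
  can be chosen among the non-atoms arbitrarily close to \<open>l\<close>.\<close>

lemma weak_conv_m_tendsto_cdf:
  assumes conv: "weak_conv_m \<mu> \<nu>"
    and \<mu>: "\<And>k. real_distribution (\<mu> k)" and \<nu>: "real_distribution \<nu>"
    and k: "filterlim k at_top F" and y: "(y \<longlongrightarrow> l) F"
    and l: "isCont (cdf \<nu>) l"
  shows "((\<lambda>n. cdf (\<mu> (k n)) (y n)) \<longlongrightarrow> cdf \<nu> l) F"
proof -
  interpret \<nu>: real_distribution \<nu> by fact
  have conv': "((\<lambda>n. cdf (\<mu> (k n)) z) \<longlongrightarrow> cdf \<nu> z) F" if "measure \<nu> {z} = 0" for z
  proof -
    have "(\<lambda>n. cdf (\<mu> n) z) \<longlonglongrightarrow> cdf \<nu> z"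
      using conv that unfolding weak_conv_m_def weak_conv_def \<nu>.isCont_cdf by simp
    then show ?thesis
      using k by (rule filterlim_compose)
  qed
  have mono: "cdf (\<mu> i) u \<le> cdf (\<mu> i) v" if "u \<le> v" for i u v
  proof -
    interpret real_distribution "\<mu> i" by fact
    show ?thesis using that by (rule cdf_nondecreasing)
  qed
  have avoid: "\<exists>z. u < z \<and> z < v \<and> measure \<nu> {z} = 0" if "u < v" for u v
    using real_interval_avoid_countable_set[OF that \<nu>.countable_support] by auto
  show ?thesis
  proof (rule order_tendstoI)
    fix c assume "c < cdf \<nu> l"
    then have "\<forall>\<^sub>F z in at l. c < cdf \<nu> z"
      using l by (auto simp: isCont_def order_tendsto_iff)
    then obtain d where d: "0 < d" "\<And>z. z \<noteq> l \<Longrightarrow> dist z l < d \<Longrightarrow> c < cdf \<nu> z"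
      by (auto simp: eventually_at)
    obtain z where z: "l - d < z" "z < l" "measure \<nu> {z} = 0"
      using avoid[of "l - d" l] d by auto
    have "\<forall>\<^sub>F n in F. c < cdf (\<mu> (k n)) z"
      using conv'[OF z(3)] d(2)[of z] z by (auto simp: order_tendsto_iff dist_real_def)
    moreover have "\<forall>\<^sub>F n in F. z < y n"
      using y z by (auto simp: order_tendsto_iff)
    ultimately show "\<forall>\<^sub>F n in F. c < cdf (\<mu> (k n)) (y n)"
      by eventually_elim (rule less_le_trans[OF _ mono[OF less_imp_le]])
  next
    fix c assume "cdf \<nu> l < c"
    then have "\<forall>\<^sub>F z in at l. cdf \<nu> z < c"
      using l by (auto simp: isCont_def order_tendsto_iff)
    then obtain d where d: "0 < d" "\<And>z. z \<noteq> l \<Longrightarrow> dist z l < d \<Longrightarrow> cdf \<nu> z < c"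
      by (auto simp: eventually_at)
    obtain z where z: "l < z" "z < l + d" "measure \<nu> {z} = 0"
      using avoid[of l "l + d"] d by auto
    have "\<forall>\<^sub>F n in F. cdf (\<mu> (k n)) z < c"
      using conv'[OF z(3)] d(2)[of z] z by (auto simp: order_tendsto_iff dist_real_def)
    moreover have "\<forall>\<^sub>F n in F. y n < z"
      using y z by (auto simp: order_tendsto_iff)
    ultimately show "\<forall>\<^sub>F n in F. cdf (\<mu> (k n)) (y n) < c"
      by eventually_elim (rule le_less_trans[OF mono[OF less_imp_le]])
  qed
qed

lemma slowly_varying_tendsto_regularly_varying:
  assumes "slowly_varying s" "0 < r" and b: "\<And>y. 0 < y \<Longrightarrow> b y = y powr \<rho> * s y"
  shows "((\<lambda>t. b (r * t) / b t) \<longlongrightarrow> r powr \<rho>) at_top"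
proof -
  have "((\<lambda>t. r powr \<rho> * (s (r * t) / s t)) \<longlongrightarrow> r powr \<rho> * 1) at_top"
    using assms by (intro tendsto_intros) (simp add: slowly_varying_def)
  moreover have "\<forall>\<^sub>F t in at_top. r powr \<rho> * (s (r * t) / s t) = b (r * t) / b t"
    using eventually_gt_at_top[of 0]
    by eventually_elim (use assms in \<open>simp add: b powr_mult\<close>)
  ultimately show ?thesis
    by (simp add: tendsto_cong)
qed

text \<open>Monotonicity replaces the uniform convergence theorem for slowly varying functions.\<close>

lemma regularly_varying_tendsto_moving:
  assumes s: "slowly_varying s" and b: "\<And>y. 0 < y \<Longrightarrow> b y = y powr \<rho> * s y"
    and mono: "mono_on {0..} b"
    and t: "filterlim t at_top F" and z: "((\<lambda>n. z n / t n) \<longlongrightarrow> r) F" and r: "0 < r"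
  shows "((\<lambda>n. b (z n) / b (t n)) \<longlongrightarrow> r powr \<rho>) F"
proof -
  have lim: "((\<lambda>n. b (r' * t n) / b (t n)) \<longlongrightarrow> r' powr \<rho>) F" if "0 < r'" for r'
    using slowly_varying_tendsto_regularly_varying[where b = b, OF s that b] t
    by (rule filterlim_compose)
  have pos: "0 < b y" if "0 < y" for y
    using s that by (simp add: b slowly_varying_def)
  have t0: "\<forall>\<^sub>F n in F. 0 < t n"
    using t by (simp add: filterlim_at_top_dense)
  have cont: "((\<lambda>r'. r' powr \<rho>) \<longlongrightarrow> r powr \<rho>) (at r)"
    using r by (intro tendsto_intros) auto
  show ?thesis
  proof (rule order_tendstoI)
    fix c assume "c < r powr \<rho>"
    then obtain d where d: "0 < d" "\<And>r'. r' \<noteq> r \<Longrightarrow> dist r' r < d \<Longrightarrow> c < r' powr \<rho>"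
      using order_tendstoD(1)[OF cont, of c] by (auto simp: eventually_at)
    \<comment> \<open>The \<open>min\<close> keeps \<open>r'\<close> positive, as \<open>lim\<close>
      requires, while \<open>r'\<close> stays within \<open>d\<close> of \<open>r\<close>.\<close>
    define r' where "r' = r - min d r / 2"
    have r': "0 < r'" "r' < r" "c < r' powr \<rho>"
      using d r by (auto simp: r'_def dist_real_def intro!: d(2))
    have "\<forall>\<^sub>F n in F. c < b (r' * t n) / b (t n)"
      using lim[OF r'(1)] r'(3) by (rule order_tendstoD)
    moreover have "\<forall>\<^sub>F n in F. r' < z n / t n"
      using z r'(2) by (rule order_tendstoD)
    ultimately show "\<forall>\<^sub>F n in F. c < b (z n) / b (t n)"
      using t0
    proof eventually_elim
      case (elim n)
      have "0 < r' * t n" "r' * t n < z n"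
        using elim r' by (simp_all add: pos_less_divide_eq)
      then have "b (r' * t n) \<le> b (z n)"
        by (intro mono_onD[OF mono]) auto
      then show ?case
        using elim divide_right_mono[OF _ less_imp_le[OF pos[of "t n"]]] by (blast intro: less_le_trans)
    qed
  next
    fix c assume "r powr \<rho> < c"
    then obtain d where d: "0 < d" "\<And>r'. r' \<noteq> r \<Longrightarrow> dist r' r < d \<Longrightarrow> r' powr \<rho> < c"
      using order_tendstoD(2)[OF cont, of c] by (auto simp: eventually_at)
    define r' where "r' = r + d / 2"
    have r': "0 < r'" "r < r'" "r' powr \<rho> < c"
      using d r by (auto simp: r'_def dist_real_def intro!: d(2))
    have "\<forall>\<^sub>F n in F. b (r' * t n) / b (t n) < c"
      using lim[OF r'(1)] r'(3) by (rule order_tendstoD)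
    \<comment> \<open>Monotonicity of \<open>b\<close> is assumed on \<open>{0..}\<close>, so
      \<open>z n\<close> must eventually be positive; for the lower bound this followed from
      \<open>r' * t n < z n\<close>.\<close>
    moreover have "\<forall>\<^sub>F n in F. z n / t n < r'" "\<forall>\<^sub>F n in F. 0 < z n / t n"
      using z r r'(2) by (auto intro: order_tendstoD)
    ultimately show "\<forall>\<^sub>F n in F. b (z n) / b (t n) < c"
      using t0
    proof eventually_elim
      case (elim n)
      have "0 < z n" "z n < r' * t n"
        using elim by (simp_all add: pos_divide_less_eq zero_less_divide_iff)
      then have "b (z n) \<le> b (r' * t n)"
        by (intro mono_onD[OF mono]) auto
      then show ?case
        using elim divide_right_mono[OF _ less_imp_le[OF pos[of "t n"]]] by (blast intro: le_less_trans)
    qed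
  qed
qed

section \<open>Independence and the Markov property of the Galton-Watson process\<close>

text \<open>Injectivity makes the singleton blocks \<open>{f j}\<close> disjoint, so independence of
  disjoint blocks applies; each block is then projected to its only coordinate.\<close>

lemma (in prob_space) indep_vars_reindex:
  assumes "indep_vars M' X I" and "inj_on f J" "f ` J \<subseteq> I"
  shows "indep_vars (\<lambda>j. M' (f j)) (\<lambda>j. X (f j)) J"
proof -
  have "indep_vars (\<lambda>j. PiM {f j} M') (\<lambda>j w. restrict (\<lambda>i. X i w) {f j}) J"
    using assms by (intro indep_vars_restrict[OF assms(1)]) (auto simp: disjoint_family_on_def inj_on_def)
  then have "indep_vars (\<lambda>j. M' (f j)) (\<lambda>j w. (\<lambda>g. g (f j)) (restrict (\<lambda>i. X i w) {f j})) J"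
    by (rule indep_vars_compose2) simp
  then show ?thesis
    by simp
qed

text \<open>The joint law of an independent family is the product of its marginals. Equal marginals
  thus give equal joint laws, even on different spaces, and the sum is a function of the family. The
  empty family is treated apart: both sums are then constantly \<open>0\<close>.\<close>

lemma distr_sum_indep_cong:
  fixes X :: "nat \<Rightarrow> 'a \<Rightarrow> real" and Y :: "nat \<Rightarrow> 'b \<Rightarrow> real"
  assumes M: "prob_space M" and N: "prob_space N"
    and X: "prob_space.indep_vars M (\<lambda>_. borel) X {..<k}"
    and Y: "prob_space.indep_vars N (\<lambda>_. borel) Y {..<k}"
    and D: "\<And>i. i < k \<Longrightarrow> distr M borel (X i) = distr N borel (Y i)"
  shows "distr M borel (\<lambda>w. \<Sum>i<k. X i w) = distr N borel (\<lambda>v. \<Sum>i<k. Y i v)"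
proof (cases "k = 0")
  case True
  then show ?thesis
    using M N by (auto intro!: measure_eqI simp: emeasure_distr prob_space.emeasure_space_1 vimage_def
        intro: Collect_cong)
next
  case False
  interpret M: prob_space M by fact
  interpret N: prob_space N by fact
  let ?P = "\<Pi>\<^sub>M i\<in>{..<k}. (borel :: real measure)"
  have X_rv [measurable]: "X i \<in> borel_measurable M" if "i \<in> {..<k}" for i
    using X that unfolding M.indep_vars_def by auto
  have Y_rv [measurable]: "Y i \<in> borel_measurable N" if "i \<in> {..<k}" for i
    using Y that unfolding N.indep_vars_def by auto
  have "distr M ?P (\<lambda>w. \<lambda>i\<in>{..<k}. X i w) = (\<Pi>\<^sub>M i\<in>{..<k}. distr M borel (X i))"
    using X False by (subst (asm) M.indep_vars_iff_distr_eq_PiM') auto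
  also have "\<dots> = (\<Pi>\<^sub>M i\<in>{..<k}. distr N borel (Y i))"
    using D by (intro PiM_cong) auto
  also have "\<dots> = distr N ?P (\<lambda>v. \<lambda>i\<in>{..<k}. Y i v)"
    using Y False by (subst (asm) N.indep_vars_iff_distr_eq_PiM') auto
  finally have eq: "distr M ?P (\<lambda>w. \<lambda>i\<in>{..<k}. X i w) = distr N ?P (\<lambda>v. \<lambda>i\<in>{..<k}. Y i v)" .
  have "distr M borel (\<lambda>w. \<Sum>i<k. X i w) =
      distr (distr M ?P (\<lambda>w. \<lambda>i\<in>{..<k}. X i w)) borel (\<lambda>f. \<Sum>i<k. f i)"
    by (subst distr_distr) (auto simp: comp_def intro!: distr_cong)
  also have "\<dots> = distr N borel (\<lambda>v. \<Sum>i<k. Y i v)"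
    unfolding eq by (subst distr_distr) (auto simp: comp_def intro!: distr_cong)
  finally show ?thesis .
qed

text \<open>\<open>f (n, i)\<close> is the number of children of the \<open>i\<close>-th individual of generation \<open>n\<close>.\<close>

primrec gw_size :: "nat \<Rightarrow> (nat \<times> nat \<Rightarrow> nat) \<Rightarrow> nat" where
  "gw_size 0 f = 1"
| "gw_size (Suc n) f = (\<Sum>i<gw_size n f. f (n, i))"

text \<open>Generation \<open>n\<close> reads only the offspring of earlier generations, so the
  coordinates in \<open>{..<n} \<times> UNIV\<close> suffice; this is what later makes it
  independent of the offspring of generation \<open>n\<close>. The number of summands is random but
  takes countably many values, so it is enough to treat each fixed \<open>k\<close>.\<close>

lemma measurable_gw_size:
  assumes "{..<n} \<times> UNIV \<subseteq> J"
  shows "gw_size n \<in> measurable (\<Pi>\<^sub>M _\<in>J. count_space UNIV) (count_space UNIV)"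
  using assms
proof (induction n)
  case (Suc n)
  have *: "(\<lambda>f. f (n, i)) \<in> measurable (\<Pi>\<^sub>M _\<in>J. count_space UNIV) (count_space (UNIV :: nat set))" for i
    using Suc.prems by (intro measurable_component_singleton) auto
  have "(\<lambda>f. \<Sum>i<k. f (n, i)) \<in> measurable (\<Pi>\<^sub>M _\<in>J. count_space UNIV) (count_space (UNIV :: nat set))" for k
  proof -
    have "(\<lambda>f. \<Sum>i<k. f (n, i)) \<in> borel_measurable (\<Pi>\<^sub>M _\<in>J. count_space (UNIV :: nat set))"
      using * by (intro borel_measurable_sum) (simp add: measurable_cong_sets[OF refl sets_borel_eq_count_space])
    then show ?thesis
      by (simp add: measurable_cong_sets[OF refl sets_borel_eq_count_space])
  qed
  moreover have "gw_size n \<in> measurable (\<Pi>\<^sub>M _\<in>J. count_space UNIV) (count_space UNIV)"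
    using Suc by (meson Suc_n_not_le_n lessI lessThan_subset_iff order.trans Sigma_mono less_imp_le subset_refl)
  ultimately show ?case
    using measurable_compose_countable[where f = "\<lambda>k f. \<Sum>i<k. f (n, i)" and g = "gw_size n"] by simp
qed (simp add: gw_size.simps(1)[abs_def])

lemma gw_size_cong: "(\<And>j i. j < n \<Longrightarrow> f (j, i) = g (j, i)) \<Longrightarrow> gw_size n f = gw_size n g"
  by (induction n) auto

text \<open>The Markov property at time \<open>n\<close>, with the offspring of generation \<open>n\<close> replaced by an
  independent copy on another probability space.\<close>

lemma galton_watson_transition:
  fixes M :: "'a measure" and N :: "'b measure" and Y :: "nat \<Rightarrow> 'b \<Rightarrow> real" and c :: real
  assumes GW: "galton_watson M p Z" and N: "prob_space N"
    and Y: "prob_space.indep_vars N (\<lambda>_. borel) Y UNIV"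
    and D: "\<And>i. distr N borel (Y i) = distr M borel (\<lambda>w. real (Z 1 w) - c)"
    and Q: "\<And>k. Measurable.pred borel (Q k)"
  shows "Z n \<in> measurable M (count_space UNIV)" (is ?meas)
    and "measure M {w \<in> space M. Q (Z n w) (real (Z (Suc n) w) - c * real (Z n w))} =
      (\<integral>w. measure N {v \<in> space N. Q (Z n w) (\<Sum>i<Z n w. Y i v)} \<partial>M)" (is "?lhs = ?rhs")
proof -
  have M: "prob_space M" using GW by (simp add: galton_watson_def)
  interpret prob_space M by fact
  interpret N: prob_space N by fact
  obtain \<xi> :: "nat \<Rightarrow> nat \<Rightarrow> 'a \<Rightarrow> nat" where
      ind: "indep_vars (\<lambda>_. count_space UNIV) (\<lambda>(n, i). \<xi> n i) UNIV"
    and law: "\<And>n i. distr M (count_space UNIV) (\<xi> n i) = measure_pmf p"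
    and Z0: "\<And>w. w \<in> space M \<Longrightarrow> Z 0 w = 1"
    and ZS: "\<And>n w. w \<in> space M \<Longrightarrow> Z (Suc n) w = (\<Sum>i<Z n w. \<xi> n i w)"
    using GW unfolding galton_watson_def by blast
  have \<xi>_meas [measurable]: "\<xi> n i \<in> measurable M (count_space UNIV)" for n i
    using ind unfolding indep_vars_def by (auto dest: spec[of _ n])
  define C where "C = (count_space UNIV :: nat measure)"
  \<comment> \<open>\<open>J\<close> indexes the past and \<open>I\<close> the offspring of
    generation \<open>n\<close>. The blocks are disjoint, so \<open>A\<close> and \<open>B\<close>
    are independent, and \<open>Z n\<close> is a function of \<open>A\<close> alone.\<close>
  define J where "J = {..<n} \<times> (UNIV :: nat set)"
  define I where "I = {n} \<times> (UNIV :: nat set)"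
  define A where "A = (\<lambda>w. \<lambda>j\<in>J. (case j of (n, i) \<Rightarrow> \<xi> n i) w)"
  define B where "B = (\<lambda>w. \<lambda>j\<in>I. (case j of (n, i) \<Rightarrow> \<xi> n i) w)"
  have "Z n w = gw_size n (\<lambda>(j, i). \<xi> j i w)" if "w \<in> space M" for w
    by (induction n) (use Z0 ZS that in auto)
  then have Zn: "Z n w = (gw_size n \<circ> A) w" if "w \<in> space M" for w
    unfolding comp_def using that by (auto intro!: gw_size_cong simp: A_def J_def)
  have AB: "indep_var (PiM J (\<lambda>_. C)) A (PiM I (\<lambda>_. C)) B"
    unfolding A_def B_def C_def by (rule indep_var_restrict[OF ind]) (auto simp: I_def J_def)
  then have rv: "A \<in> measurable M (PiM J (\<lambda>_. C))" "B \<in> measurable M (PiM I (\<lambda>_. C))"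
    and prod: "distr M (PiM J (\<lambda>_. C)) A \<Otimes>\<^sub>M distr M (PiM I (\<lambda>_. C)) B =
      distr M (PiM J (\<lambda>_. C) \<Otimes>\<^sub>M PiM I (\<lambda>_. C)) (\<lambda>w. (A w, B w))"
    by (auto simp: indep_var_distribution_eq)
  have gw_meas: "gw_size n \<in> measurable (PiM J (\<lambda>_. C)) C"
    unfolding C_def by (rule measurable_gw_size) (simp add: J_def)
  show Z_meas: ?meas
    using measurable_comp[OF rv(1) gw_meas] Zn unfolding C_def
    by (metis (mono_tags, lifting) measurable_cong)
  interpret B: prob_space "distr M (PiM I (\<lambda>_. C)) B"
    using rv(2) by (rule prob_space_distr)
  let ?S = "\<lambda>k f. \<Sum>i<k. real (f (n, i)) - c"
  \<comment> \<open>The event as a set of pairs: \<open>fst u\<close> is the past, which fixes the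
    number of summands, and \<open>snd u\<close> supplies the summands.\<close>
  define E where "E = {u \<in> space (PiM J (\<lambda>_. C) \<Otimes>\<^sub>M PiM I (\<lambda>_. C)).
    Q (gw_size n (fst u)) (?S (gw_size n (fst u)) (snd u))}"
  have S_meas: "(\<lambda>f. ?S k f) \<in> borel_measurable (PiM I (\<lambda>_. C))" for k
  proof -
    have "(\<lambda>f. f (n, i)) \<in> measurable (PiM I (\<lambda>_. C)) C" for i
      by (rule measurable_component_singleton) (simp add: I_def)
    then have "(\<lambda>f. real (f (n, i))) \<in> borel_measurable (PiM I (\<lambda>_. C))" for i
      by (rule measurable_compose) (simp add: C_def)
    then show ?thesis by auto
  qed
  have E: "E \<in> sets (PiM J (\<lambda>_. C) \<Otimes>\<^sub>M PiM I (\<lambda>_. C))"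
  proof -
    have "Measurable.pred (PiM J (\<lambda>_. C) \<Otimes>\<^sub>M PiM I (\<lambda>_. C)) (\<lambda>u. Q k (?S k (snd u)))" for k
      using measurable_compose[OF measurable_compose[OF measurable_snd S_meas] Q] .
    then have "Measurable.pred (PiM J (\<lambda>_. C) \<Otimes>\<^sub>M PiM I (\<lambda>_. C)) (\<lambda>u. Q (gw_size n (fst u)) (?S (gw_size n (fst u)) (snd u)))"
      by (rule measurable_compose_countable)
        (use measurable_compose[OF measurable_fst gw_meas] in \<open>simp add: C_def\<close>)
    then show ?thesis
      unfolding E_def by measurable
  qed
  have SB: "?S k (B w) = (\<Sum>i<k. real (\<xi> n i w) - c)" for k w
    by (simp add: B_def I_def)
  have sum_law: "distr M borel (\<lambda>w. \<Sum>i<k. real (\<xi> n i w) - c) = distr N borel (\<lambda>v. \<Sum>i<k. Y i v)" for k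
  proof (rule distr_sum_indep_cong)
    have "indep_vars (\<lambda>_. count_space UNIV) (\<xi> n) {..<k}"
      using indep_vars_reindex[OF ind, of "Pair n" "{..<k}"] by (simp add: inj_on_def)
    then show "indep_vars (\<lambda>_. borel) (\<lambda>i w. real (\<xi> n i w) - c) {..<k}"
      by (rule indep_vars_compose2) simp
    show "N.indep_vars (\<lambda>_. borel) Y {..<k}"
      using Y by (rule N.indep_vars_subset) simp
    fix i
    have *: "distr M borel (\<lambda>w. real (\<xi> j l w) - c) = distr (measure_pmf p) borel (\<lambda>k. real k - c)" for j l
      unfolding law[of j l, symmetric] by (subst distr_distr) (auto simp: comp_def)
    \<comment> \<open>There is a single ancestor, so \<open>Z 1\<close> is its number of children
      \<open>\<xi> 0 0\<close>; this links the law of \<open>Y i\<close> to the offspring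
      law.\<close>
    have "distr M borel (\<lambda>w. real (Z 1 w) - c) = distr M borel (\<lambda>w. real (\<xi> 0 0 w) - c)"
      using ZS[of _ 0] Z0 by (intro distr_cong) auto
    then show "distr M borel (\<lambda>w. real (\<xi> n i w) - c) = distr N borel (Y i)"
      unfolding D * by simp
  qed (rule M N)+
  have Y_meas [measurable]: "Y i \<in> borel_measurable N" for i
    using Y unfolding N.indep_vars_def by auto
  have copy: "emeasure M {w \<in> space M. Q k (\<Sum>i<k. real (\<xi> n i w) - c)} =
      emeasure N {v \<in> space N. Q k (\<Sum>i<k. Y i v)}" for k
  proof -
    have [measurable]: "{y. Q k y} \<in> sets borel"
      using Q[of k] by (simp add: pred_def)
    have "emeasure M {w \<in> space M. Q k (\<Sum>i<k. real (\<xi> n i w) - c)} =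
        emeasure (distr M borel (\<lambda>w. \<Sum>i<k. real (\<xi> n i w) - c)) {y. Q k y}"
      by (subst emeasure_distr) (auto intro!: arg_cong[where f = "emeasure M"])
    also have "\<dots> = emeasure N {v \<in> space N. Q k (\<Sum>i<k. Y i v)}"
      unfolding sum_law by (subst emeasure_distr) (auto intro!: arg_cong[where f = "emeasure N"])
    finally show ?thesis .
  qed
  have "emeasure M {w \<in> space M. Q (Z n w) (real (Z (Suc n) w) - c * real (Z n w))} =
      emeasure M ((\<lambda>w. (A w, B w)) -` E \<inter> space M)"
  proof (rule arg_cong[where f = "emeasure M"], rule set_eqI)
    fix w
    have "(A w, B w) \<in> space (PiM J (\<lambda>_. C) \<Otimes>\<^sub>M PiM I (\<lambda>_. C))" if "w \<in> space M"
      using that rv by (auto simp: space_pair_measure dest: measurable_space)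
    moreover have "(\<Sum>i<Z n w. real (\<xi> n i w) - c) = real (Z (Suc n) w) - c * real (Z n w)"
      if "w \<in> space M"
      using that by (simp add: ZS sum_subtractf mult.commute)
    ultimately show "w \<in> {w \<in> space M. Q (Z n w) (real (Z (Suc n) w) - c * real (Z n w))} \<longleftrightarrow>
        w \<in> (\<lambda>w. (A w, B w)) -` E \<inter> space M"
      using Zn[of w] SB by (auto simp: E_def)
  qed
  also have "\<dots> = emeasure (distr M (PiM J (\<lambda>_. C) \<Otimes>\<^sub>M PiM I (\<lambda>_. C)) (\<lambda>w. (A w, B w))) E"
    using rv E by (subst emeasure_distr) auto
  \<comment> \<open>Fubini with the past held fixed: in each section the number of summands is a
    constant, so \<open>copy\<close> can replace the offspring by the variables
    \<open>Y i\<close>.\<close>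
  also have "\<dots> = (\<integral>\<^sup>+f. emeasure (distr M (PiM I (\<lambda>_. C)) B) (Pair f -` E) \<partial>distr M (PiM J (\<lambda>_. C)) A)"
    unfolding prod[symmetric] using E by (intro B.emeasure_pair_measure_alt) simp
  also have "\<dots> = (\<integral>\<^sup>+w. emeasure (distr M (PiM I (\<lambda>_. C)) B) (Pair (A w) -` E) \<partial>M)"
    using rv(1) B.measurable_emeasure_Pair[of E "PiM J (\<lambda>_. C)"] E by (subst nn_integral_distr) auto
  also have "\<dots> = (\<integral>\<^sup>+w. emeasure N {v \<in> space N. Q (Z n w) (\<Sum>i<Z n w. Y i v)} \<partial>M)"
  proof (rule nn_integral_cong)
    fix w assume w: "w \<in> space M"
    have "emeasure (distr M (PiM I (\<lambda>_. C)) B) (Pair (A w) -` E) =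
        emeasure M (B -` (Pair (A w) -` E) \<inter> space M)"
      using rv(2) sets_Pair1[OF E] by (rule emeasure_distr)
    also have "B -` (Pair (A w) -` E) \<inter> space M =
        {w' \<in> space M. Q (Z n w) (\<Sum>i<Z n w. real (\<xi> n i w') - c)}"
      using measurable_space[OF rv(1)] measurable_space[OF rv(2)] SB Zn w
      by (auto simp: E_def space_pair_measure)
    finally show "emeasure (distr M (PiM I (\<lambda>_. C)) B) (Pair (A w) -` E) =
        emeasure N {v \<in> space N. Q (Z n w) (\<Sum>i<Z n w. Y i v)}"
      using copy Zn[OF w] by simp
  qed
  also have "\<dots> = (\<integral>\<^sup>+w. ennreal (measure N {v \<in> space N. Q (Z n w) (\<Sum>i<Z n w. Y i v)}) \<partial>M)"
    by (simp add: N.emeasure_eq_measure)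
  also have "\<dots> = ennreal ?rhs"
  proof (rule nn_integral_eq_integral)
    have "(\<lambda>w. measure N {v \<in> space N. Q (Z n w) (\<Sum>i<Z n w. Y i v)}) \<in> borel_measurable M"
      using Z_meas by (rule measurable_compose) simp
    then show "integrable M (\<lambda>w. measure N {v \<in> space N. Q (Z n w) (\<Sum>i<Z n w. Y i v)})"
      by (intro integrable_const_bound[where B = 1]) auto
  qed simp
  finally show "?lhs = ?rhs"
    by (simp add: emeasure_eq_measure integral_nonneg_AE)
qed

section \<open>Limit law of the normalised ratio of successive generations\<close>

theorem corollary1p17:
  fixes M :: "'a measure" and N :: "'b measure" and K :: "'c measure"
    and p :: "nat pmf" and Z :: "nat \<Rightarrow> 'a \<Rightarrow> nat" and W :: "'a \<Rightarrow> real"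
    and X :: "nat \<Rightarrow> 'b \<Rightarrow> real" and U :: "'c \<Rightarrow> real"
    and \<omega> L b s :: "real \<Rightarrow> real" and m \<beta> x :: real
  assumes GW: "galton_watson M p Z"
    and p0: "pmf p 0 = 0"
    and p1: "0 < pmf p 1" "pmf p 1 < 1"
    and mean: "(\<lambda>k. real k * pmf p k) sums m"
    and m_gt_1: "1 < m"
    and Z_log_Z: "integrable M (\<lambda>w. real (Z 1 w) * ln (real (Z 1 w)))"
    and W_lim: "AE w in M. (\<lambda>n. real (Z n w) / m ^ n) \<longlonglongrightarrow> W w"
    and W_density: "distributed M lborel W (\<lambda>u. ennreal (indicator {0<..} u * \<omega> u))"
    and \<omega>_nonneg: "\<And>u. 0 < u \<Longrightarrow> 0 \<le> \<omega> u"
    and \<omega>_cont: "continuous_on {0<..} \<omega>"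
    and L_pos: "\<And>y. 0 \<le> y \<Longrightarrow> 0 < L y"
    and L_sv: "slowly_varying L"
    and L_bounded: "\<And>C. compact C \<Longrightarrow> C \<subseteq> {0..} \<Longrightarrow> \<exists>c>0. \<exists>d. \<forall>y\<in>C. c \<le> L y \<and> L y \<le> d"
    and \<beta>: "1 < \<beta>" "\<beta> < 2"
    and tail: "(\<lambda>y. measure M {w \<in> space M. real (Z 1 w) > y}) \<sim>[at_top] (\<lambda>y. y powr (-\<beta>) * L y)"
    and N: "prob_space N"
    and X_indep: "prob_space.indep_vars N (\<lambda>_. borel) X {1..}"
    and X_law: "\<And>i. 1 \<le> i \<Longrightarrow> distr N borel (X i) = distr M borel (\<lambda>w. real (Z 1 w) - m)"
    and b_cont: "continuous_on {0..} b"
    and b_mono: "mono_on {0..} b"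
    and b_onto: "b ` {0..} = {0..}"
    and b_0: "b 0 = 0"
    and b_eq: "\<And>y. 0 < y \<Longrightarrow> b y = y powr (1 / \<beta>) * s y"
    and s_pos: "\<And>y. 0 < y \<Longrightarrow> 0 < s y"
    and s_sv: "slowly_varying s"
    and s_liminf: "Liminf at_top (\<lambda>y. ereal (s y)) > 0"
    and K: "prob_space K"
    and U_rv: "U \<in> borel_measurable K"
    and U_stable: "strictly_stable \<beta> (distr K borel U)"
    and attraction: "weak_conv_m (\<lambda>k. distr N borel (\<lambda>v. (\<Sum>i=1..k. X i v) / b (real k)))
                       (distr K borel U)"
  shows "(\<lambda>n. measure M {w \<in> space M.
             m ^ n / b (m ^ n) * (real (Z (n + 1) w) / real (Z n w) - m) \<le> x})
         \<longlonglongrightarrow> (LBINT u:{0<..}.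
               measure K {v \<in> space K. U v \<le> u powr ((\<beta> - 1) / \<beta>) * x} * \<omega> u)"
proof -
  have M: "prob_space M"
    using GW by (simp add: galton_watson_def)
  interpret M: prob_space M by fact
  interpret N: prob_space N by fact
  interpret K: prob_space K by fact
  define \<nu> where "\<nu> = distr K borel U"
  interpret \<nu>: real_distribution \<nu>
    unfolding \<nu>_def using U_rv by (simp add: K.real_distribution_distr)
  define \<mu> where "\<mu> k = distr N borel (\<lambda>v. (\<Sum>i=1..k. X i v) / b (real k))" for k
  have X_rv [measurable]: "X i \<in> borel_measurable N" if "i \<in> {1..}" for i
    using X_indep that unfolding N.indep_vars_def by auto
  have \<mu>: "real_distribution (\<mu> k)" for k
    unfolding \<mu>_def by (rule N.real_distribution_distr) auto
  have b_pos: "0 < b y" if "0 < y" for y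
    using b_eq s_pos that by simp
  have W_rv [measurable]: "W \<in> borel_measurable M"
    using distributed_measurable[OF W_density] by simp
  \<comment> \<open>This is \<open>1 - 1 / \<beta>\<close>: the exponent \<open>1\<close> comes from
    \<open>Z n / m ^ n\<close>, and \<open>- 1 / \<beta>\<close> from
    \<open>b (m ^ n) / b (Z n)\<close>.\<close>
  define \<gamma> where "\<gamma> = (\<beta> - 1) / \<beta>"

  \<comment> \<open>The \<open>X i\<close> are numbered from \<open>1\<close>, individuals of a
    generation from \<open>0\<close>.\<close>
  define Y where "Y i = X (Suc i)" for i
  have Y: "N.indep_vars (\<lambda>_. borel) Y UNIV"
    unfolding Y_def by (rule N.indep_vars_reindex[OF X_indep]) auto
  have D: "distr N borel (Y i) = distr M borel (\<lambda>w. real (Z 1 w) - m)" for i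
    unfolding Y_def by (rule X_law) simp
  \<comment> \<open>Written so that it matches the event also for \<open>k = 0\<close>, where division by \<open>k\<close> gives \<open>0\<close>.\<close>
  define Q where "Q n k y \<longleftrightarrow> m ^ n / b (m ^ n) * ((y + m * real k) / real k - m) \<le> x" for n k y
  have Q: "Measurable.pred borel (Q n k)" for n k
    unfolding Q_def by measurable
  define G where "G n k = measure N {v \<in> space N. Q n k (\<Sum>i<k. Y i v)}" for n k
  have Z_meas: "Z n \<in> measurable M (count_space UNIV)" for n
    by (rule galton_watson_transition(1)[OF GW N Y D Q])
  have law: "measure M {w \<in> space M.
      m ^ n / b (m ^ n) * (real (Z (n + 1) w) / real (Z n w) - m) \<le> x} = (\<integral>w. G n (Z n w) \<partial>M)" for n
    using galton_watson_transition(2)[OF GW N Y D, of "Q n" n, OF Q]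
    by (simp add: Q_def G_def)

  \<comment> \<open>Multiplying the inequality in \<open>Q\<close> by the positive number
    \<open>c\<close> turns its left side into \<open>S_k / b k\<close>. Positivity of
    \<open>c\<close> and the cancellation of \<open>k\<close> need \<open>0 < k\<close>.\<close>
  have G_cdf: "G n k = cdf (\<mu> k) (x * (real k / m ^ n) * (b (m ^ n) / b (real k)))" if "0 < k" for n k
  proof -
    have "0 < b (real k)" "0 < b (m ^ n)" "0 < m ^ n"
      using b_pos that m_gt_1 by auto
    moreover define c where "c = real k / m ^ n * (b (m ^ n) / b (real k))"
    ultimately have "0 < c" and c: "m ^ n / b (m ^ n) * (y / real k) * c = y / b (real k)" for y
      using that m_gt_1 by simp_all
    have "Q n k y \<longleftrightarrow> m ^ n / b (m ^ n) * (y / real k) \<le> x" for y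
      using that by (simp add: Q_def add_divide_distrib)
    moreover have "(m ^ n / b (m ^ n) * (y / real k) \<le> x) \<longleftrightarrow>
        m ^ n / b (m ^ n) * (y / real k) * c \<le> x * c" for y
      using \<open>0 < c\<close> by (rule mult_le_cancel_right_pos[symmetric])
    moreover have "(m ^ n / b (m ^ n) * (y / real k) * c \<le> x * c) \<longleftrightarrow>
        y / b (real k) \<le> x * (real k / m ^ n) * (b (m ^ n) / b (real k))" for y
      unfolding c by (simp only: c_def mult.assoc)
    ultimately have "Q n k y \<longleftrightarrow> y / b (real k) \<le> x * (real k / m ^ n) * (b (m ^ n) / b (real k))" for y
      by simp
    moreover have "(\<Sum>i<k. Y i v) = (\<Sum>i=1..k. X i v)" for v
      unfolding Y_def by (simp add: sum.atLeast1_atMost_eq)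
    ultimately show ?thesis
      unfolding G_def cdf_def \<mu>_def
      by (subst measure_distr) (auto intro!: arg_cong[where f = "measure N"])
  qed

  have "AE w in M. 0 < W w \<and> measure \<nu> {W w powr \<gamma> * x} = 0"
  proof -
    \<comment> \<open>The values \<open>u > 0\<close> for which \<open>u powr \<gamma> * x\<close>
      is an atom, found by solving for \<open>u\<close> when \<open>x \<noteq> 0\<close>. For
      \<open>x = 0\<close> division by zero leaves at most the point \<open>0\<close> in
      \<open>A\<close>, and the atom at \<open>0\<close> is excluded by stability instead.\<close>
    define A where "A = (\<lambda>z. (z / x) powr (1 / \<gamma>)) ` {z. measure \<nu> {z} \<noteq> 0}"
    have A: "countable A"
      unfolding A_def by (intro countable_image \<nu>.countable_support)
    have "AE u in lborel. u \<notin> A"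
      using A by (intro AE_not_in countable_imp_null_set_lborel)
    \<comment> \<open>The indicator in the density forces \<open>W > 0\<close>, and absolute
      continuity turns the Lebesgue null set \<open>A\<close> into a null event for
      \<open>W\<close>.\<close>
    then have "AE u in lborel. 0 < ennreal (indicator {0<..} u * \<omega> u) \<longrightarrow> 0 < u \<and> u \<notin> A"
      by eventually_elim (auto simp: indicator_def split: if_splits)
    moreover have "Measurable.pred lborel (\<lambda>u. 0 < u \<and> u \<notin> A)"
      using sets.countable[of A borel] A by (auto simp: pred_def)
    ultimately have "AE w in M. 0 < W w \<and> W w \<notin> A"
      by (intro M.distributed_AE2[OF W_density, THEN iffD2])
    then show ?thesis
    proof eventually_elim
      case (elim w)
      have "measure \<nu> {W w powr \<gamma> * x} = 0"
      proof (cases "x = 0")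
        case True
        then show ?thesis
          using strictly_stable_no_atom_at_0[OF U_stable] by (simp add: \<nu>_def)
      next
        case False
        have "\<gamma> \<noteq> 0"
          using \<beta> by (simp add: \<gamma>_def)
        then have eq: "W w = (W w powr \<gamma> * x / x) powr (1 / \<gamma>)"
          using elim False by (simp add: powr_powr)
        have "W w \<in> A" if "measure \<nu> {W w powr \<gamma> * x} \<noteq> 0"
          unfolding A_def using that eq by (intro image_eqI[where x = "W w powr \<gamma> * x"]) auto
        then show ?thesis
          using elim by blast
      qed
      then show ?case
        using elim by simp
    qed
  qed
  then have conv: "AE w in M. (\<lambda>n. G n (Z n w)) \<longlonglongrightarrow> cdf \<nu> (W w powr \<gamma> * x)"
    using W_lim
  proof eventually_elim
    case (elim w)
    then have W: "0 < W w" and W0: "W w \<noteq> 0" by auto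
    have m_lim: "filterlim (\<lambda>n. m ^ n) at_top sequentially"
      by (rule filterlim_at_infinity_imp_filterlim_at_top[OF filterlim_realpow_sequentially_gt1])
        (use m_gt_1 in auto)
    \<comment> \<open>Since \<open>W w > 0\<close>, the generation sizes tend to infinity along this
      path, so the weak convergence of \<open>\<mu> k\<close> may be used at the index
      \<open>k = Z n w\<close>.\<close>
    have "filterlim (\<lambda>n. real (Z n w) / m ^ n * m ^ n) at_top sequentially"
      using elim(2) W m_lim by (rule filterlim_tendsto_pos_mult_at_top)
    then have "filterlim (\<lambda>n. real (Z n w)) at_top sequentially"
      using m_gt_1 by simp
    then have Z_lim: "filterlim (\<lambda>n. Z n w) at_top sequentially"
      by (simp add: filterlim_sequentially_iff_filterlim_real)
    have "(\<lambda>n. b (real (Z n w)) / b (m ^ n)) \<longlonglongrightarrow> W w powr (1 / \<beta>)"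
      using regularly_varying_tendsto_moving[OF s_sv b_eq b_mono m_lim elim(2) W] by simp
    then have "(\<lambda>n. inverse (b (real (Z n w)) / b (m ^ n))) \<longlonglongrightarrow> inverse (W w powr (1 / \<beta>))"
      using W by (intro tendsto_inverse) auto
    then have "(\<lambda>n. x * (real (Z n w) / m ^ n) * inverse (b (real (Z n w)) / b (m ^ n)))
        \<longlonglongrightarrow> x * W w * inverse (W w powr (1 / \<beta>))"
      using elim(2) by (intro tendsto_mult tendsto_const)
    moreover have "x * W w * inverse (W w powr (1 / \<beta>)) = W w powr \<gamma> * x"
    proof -
      have "\<gamma> = 1 - 1 / \<beta>"
        using \<beta> by (simp add: \<gamma>_def field_simps)
      then show ?thesis
        using W by (simp add: powr_diff divide_inverse)
    qed
    ultimately have "(\<lambda>n. x * (real (Z n w) / m ^ n) * (b (m ^ n) / b (real (Z n w)))) \<longlonglongrightarrow> W w powr \<gamma> * x"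
      by simp
    then have lim: "(\<lambda>n. cdf (\<mu> (Z n w)) (x * (real (Z n w) / m ^ n) * (b (m ^ n) / b (real (Z n w)))))
        \<longlonglongrightarrow> cdf \<nu> (W w powr \<gamma> * x)"
      using elim(1) attraction
      by (intro weak_conv_m_tendsto_cdf[OF _ \<mu> \<nu>.real_distribution_axioms Z_lim])
         (simp_all add: \<mu>_def[abs_def] \<nu>_def[symmetric] \<nu>.isCont_cdf)
    have "\<forall>\<^sub>F n in sequentially. 0 < Z n w"
      using Z_lim unfolding filterlim_at_top by (auto elim!: allE[of _ 1] eventually_mono)
    then have eq: "\<forall>\<^sub>F n in sequentially. cdf (\<mu> (Z n w))
        (x * (real (Z n w) / m ^ n) * (b (m ^ n) / b (real (Z n w)))) = G n (Z n w)"
      by eventually_elim (rule G_cdf[symmetric])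
    show ?case
      using lim eq by (rule Lim_transform_eventually)
  qed

  \<comment> \<open>A distribution function is monotone, hence Borel.\<close>
  have cdf_meas: "(\<lambda>u. cdf \<nu> (u powr \<gamma> * x)) \<in> borel_measurable borel"
    using borel_measurable_mono[of "cdf \<nu>"] \<nu>.cdf_nondecreasing by (auto simp: mono_def)
  have "(\<lambda>n. \<integral>w. G n (Z n w) \<partial>M) \<longlonglongrightarrow> (\<integral>w. cdf \<nu> (W w powr \<gamma> * x) \<partial>M)"
  proof (rule integral_dominated_convergence[where w = "\<lambda>_. 1"])
    show "(\<lambda>w. G n (Z n w)) \<in> borel_measurable M" for n
      using Z_meas by (rule measurable_compose) simp
    show "(\<lambda>w. cdf \<nu> (W w powr \<gamma> * x)) \<in> borel_measurable M"
      using W_rv cdf_meas by (rule measurable_compose)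
    show "AE w in M. norm (G n (Z n w)) \<le> 1" for n
      by (simp add: G_def)
  qed (use conv in simp_all)
  \<comment> \<open>The expectation over \<open>W\<close> becomes an integral against its density;
    the indicator then restricts it to \<open>{0<..}\<close>.\<close>
  also have "(\<integral>w. cdf \<nu> (W w powr \<gamma> * x) \<partial>M) =
      (\<integral>u. indicator {0<..} u * \<omega> u * cdf \<nu> (u powr \<gamma> * x) \<partial>lborel)"
    using \<omega>_nonneg cdf_meas
    by (intro distributed_integral[OF W_density, symmetric]) (auto simp: indicator_def)
  also have "\<dots> = (LBINT u:{0<..}.
      measure K {v \<in> space K. U v \<le> u powr ((\<beta> - 1) / \<beta>) * x} * \<omega> u)"
  proof -
    have "cdf \<nu> z = measure K {v \<in> space K. U v \<le> z}" for z
      unfolding cdf_def \<nu>_def using U_rv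
      by (subst measure_distr) (auto intro!: arg_cong[where f = "measure K"])
    then show ?thesis
      by (simp add: set_lebesgue_integral_def \<gamma>_def mult_ac)
  qed
  finally show ?thesis
    unfolding law .
qed

end
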